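(* Let $G$ be the group of Construction B or Construction C in the context, and assume $1<\deg(S_1)<q/p$. Then the Thompson subgroup of $G$ is $J(G)=\{\mathfrak{g}_{a,b,0}:a,b\in\mathbb{F}_q,\ \theta_{a,b,0}=1\}$, which has order $q^2$ in the case of Construction B and $q^2/p$ in the case of Construction C.
   Context: The Thompson subgroup $J(G)$ of a finite $p$-group is generated by its abelian subgroups of maximal order. $q=p^{pl}$, $p$ odd prime, $l\ge1$, $g\in\mathrm{Aut}(\mathbb{F}_q)$, $g(x)=x^{p^l}$, $\mathrm{tr}=\mathrm{tr}_{\mathbb{F}_q/\mathbb{F}_p}$. $E(a,b,c,t)$ is the matrix with rows $(1,0,0,0),(-c,1,0,0),(b-ct,t,1,0),(a,b,c,1)$; pairs $(A,\sigma)$ multiply by $(A_1,\sigma_1)\circ(A_2,\sigma_2)=(A_1^{\sigma_2}A_2,\sigma_1\sigma_2)$; $\mathfrak{g}_{a,b,c}=(E(a,b,c,T(a,b,c)),\theta_{a,b,c})$, $G=\{\mathfrak{g}_{a,b,c}:a,b,c\in\mathbb{F}_q\}$. Construction B: $S_1$ a reduced linearized polynomial ($\sum_{i=0}^{pl-1}s_iX^{p^i}$) with coefficients in $\mathbb{F}_{p^l}$; $\mu_C\in\mathbb{F}_{p^l}^*$; $\theta_{a,b,c}=g^{\mathrm{tr}(\mu_Cc)}$, $T(a,b,c)=S_1(c)$. Construction C: $\mu_B\in\mathbb{F}_{p^l}^*$; $s_i\in\mathbb{F}_{p^l}$ with $\mu_Bs_i-s_{pl-i}^{p^i}\mu_B^{p^i}=0$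 for $1\le i\le pl-1$; $S_1=\sum_{i=0}^{pl-1}s_iX^{p^i}$, $Q(x)=-\mathrm{tr}(\mu_BxS_1(x))$; $\theta_{a,b,c}=g^{\frac12Q(c)+\mathrm{tr}(\mu_Bb)}$, $T(a,b,c)=S_1(c)$. *)

theory Defs
  imports
    "HOL-Analysis.Cartesian_Space"
    "HOL-Computational_Algebra.Polynomial"
    "HOL-Computational_Algebra.Primes"
    "HOL-Algebra.Generated_Groups"
begin

text \<open>
  The field \<open>\<bbbF>\<^sub>q\<close> with \<open>q = p\<^bsup>pl\<^esup>\<close> is an arbitrary type \<open>'a :: {field, finite}\<close> with
  \<open>CARD('a) = p ^ (p * l)\<close>.
\<close>

definition abelian_subgroup :: "('b, 'c) monoid_scheme \<Rightarrow> 'b set \<Rightarrow> bool" where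
  "abelian_subgroup G A \<longleftrightarrow> subgroup A G \<and> comm_group (G\<lparr>carrier := A\<rparr>)"

definition max_order_abelian_subgroups :: "('b, 'c) monoid_scheme \<Rightarrow> 'b set set" where
  "max_order_abelian_subgroups G =
     {A. abelian_subgroup G A \<and> (\<forall>B. abelian_subgroup G B \<longrightarrow> card B \<le> card A)}"

definition thompson_subgroup :: "('b, 'c) monoid_scheme \<Rightarrow> 'b set" where
  "thompson_subgroup G = generate G (\<Union> (max_order_abelian_subgroups G))"

text \<open>The copy of \<open>\<bbbF>\<^bsub>p^l\<^esub>\<close> inside \<open>\<bbbF>\<^sub>q\<close>.\<close>

definition Fpl :: "nat \<Rightarrow> nat \<Rightarrow> 'a::field set" where
  "Fpl p l = {x. x ^ (p ^ l) = x}"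

definition frob :: "nat \<Rightarrow> nat \<Rightarrow> 'a::field \<Rightarrow> 'a" where
  "frob p l x = x ^ (p ^ l)"

text \<open>The absolute trace of \<open>\<bbbF>\<^sub>q\<close>, as an element of the prime field inside \<open>\<bbbF>\<^sub>q\<close>.\<close>

definition tr :: "nat \<Rightarrow> nat \<Rightarrow> 'a::field \<Rightarrow> 'a" where
  "tr p l x = (\<Sum>i<p * l. x ^ (p ^ i))"

text \<open>
  \<open>g\<close> has order \<open>p\<close>, so \<open>g\<^sup>e\<close> makes sense for \<open>e\<close> in the prime field; the exponent is
  lifted to its representative in \<open>{0..<p}\<close>.
\<close>

definition frob_pow :: "nat \<Rightarrow> nat \<Rightarrow> 'a::field \<Rightarrow> 'a \<Rightarrow> 'a" where
  "frob_pow p l e = (frob p l ^^ (LEAST n. of_nat n = e))"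

definition lin_poly :: "nat \<Rightarrow> nat \<Rightarrow> (nat \<Rightarrow> 'a::field) \<Rightarrow> 'a poly" where
  "lin_poly p l s = (\<Sum>i<p * l. monom (s i) (p ^ i))"

definition E :: "'a::field \<Rightarrow> 'a \<Rightarrow> 'a \<Rightarrow> 'a \<Rightarrow> 'a^4^4" where
  "E a b c t = vector [vector [1, 0, 0, 0],
                       vector [-c, 1, 0, 0],
                       vector [b - c * t, t, 1, 0],
                       vector [a, b, c, 1]]"

type_synonym 'a sl_pair = "('a^4^4) \<times> ('a \<Rightarrow> 'a)"

text \<open>
  Automorphisms act on the right (exponent notation), so the product \<open>\<sigma>\<^sub>1\<sigma>\<^sub>2\<close> applies
  \<open>\<sigma>\<^sub>1\<close> first; this is what makes the multiplication of pairs associative.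
\<close>

fun pair_mult :: "'a::field sl_pair \<Rightarrow> 'a sl_pair \<Rightarrow> 'a sl_pair" where
  "pair_mult (A1, \<sigma>1) (A2, \<sigma>2) = (map_matrix \<sigma>2 A1 ** A2, \<sigma>2 \<circ> \<sigma>1)"

definition gelem ::
  "('a::field \<Rightarrow> 'a \<Rightarrow> 'a \<Rightarrow> 'a) \<Rightarrow> ('a \<Rightarrow> 'a \<Rightarrow> 'a \<Rightarrow> 'a \<Rightarrow> 'a) \<Rightarrow>
   'a \<Rightarrow> 'a \<Rightarrow> 'a \<Rightarrow> 'a sl_pair" where
  "gelem T \<theta> a b c = (E a b c (T a b c), \<theta> a b c)"

definition ggroup ::
  "('a::field \<Rightarrow> 'a \<Rightarrow> 'a \<Rightarrow> 'a) \<Rightarrow> ('a \<Rightarrow> 'a \<Rightarrow> 'a \<Rightarrow> 'a \<Rightarrow> 'a) \<Rightarrow>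
   'a sl_pair monoid" where
  "ggroup T \<theta> = \<lparr>carrier = {gelem T \<theta> a b c | a b c. True}, mult = pair_mult, one = (mat 1, id)\<rparr>"

definition T_S1 :: "nat \<Rightarrow> nat \<Rightarrow> (nat \<Rightarrow> 'a::field) \<Rightarrow> 'a \<Rightarrow> 'a \<Rightarrow> 'a \<Rightarrow> 'a" where
  "T_S1 p l s a b c = poly (lin_poly p l s) c"

definition theta_B :: "nat \<Rightarrow> nat \<Rightarrow> 'a::field \<Rightarrow> 'a \<Rightarrow> 'a \<Rightarrow> 'a \<Rightarrow> 'a \<Rightarrow> 'a" where
  "theta_B p l \<mu> a b c = frob_pow p l (tr p l (\<mu> * c))"

definition Q_C :: "nat \<Rightarrow> nat \<Rightarrow> 'a::field \<Rightarrow> (nat \<Rightarrow> 'a) \<Rightarrow> 'a \<Rightarrow> 'a" where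
  "Q_C p l \<mu> s x = - tr p l (\<mu> * x * poly (lin_poly p l s) x)"

definition theta_C :: "nat \<Rightarrow> nat \<Rightarrow> 'a::field \<Rightarrow> (nat \<Rightarrow> 'a) \<Rightarrow> 'a \<Rightarrow> 'a \<Rightarrow> 'a \<Rightarrow> 'a \<Rightarrow> 'a" where
  "theta_C p l \<mu> s a b c = frob_pow p l (1 / 2 * Q_C p l \<mu> s c + tr p l (\<mu> * b))"

definition group_B :: "nat \<Rightarrow> nat \<Rightarrow> 'a::field \<Rightarrow> (nat \<Rightarrow> 'a) \<Rightarrow> 'a sl_pair monoid" where
  "group_B p l \<mu> s = ggroup (T_S1 p l s) (theta_B p l \<mu>)"

definition group_C :: "nat \<Rightarrow> nat \<Rightarrow> 'a::field \<Rightarrow> (nat \<Rightarrow> 'a) \<Rightarrow> 'a sl_pair monoid" where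
  "group_C p l \<mu> s = ggroup (T_S1 p l s) (theta_C p l \<mu> s)"

definition elem_B ::
  "nat \<Rightarrow> nat \<Rightarrow> 'a::field \<Rightarrow> (nat \<Rightarrow> 'a) \<Rightarrow> 'a \<Rightarrow> 'a \<Rightarrow> 'a \<Rightarrow> 'a sl_pair" where
  "elem_B p l \<mu> s = gelem (T_S1 p l s) (theta_B p l \<mu>)"

definition elem_C ::
  "nat \<Rightarrow> nat \<Rightarrow> 'a::field \<Rightarrow> (nat \<Rightarrow> 'a) \<Rightarrow> 'a \<Rightarrow> 'a \<Rightarrow> 'a \<Rightarrow> 'a sl_pair" where
  "elem_C p l \<mu> s = gelem (T_S1 p l s) (theta_C p l \<mu> s)"

lemma E_nth:
  "E a b c t $ 1 $ 1 = 1" "E a b c t $ 1 $ 2 = 0" "E a b c t $ 1 $ 3 = 0" "E a b c t $ 1 $ 4 = 0"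
  "E a b c t $ 2 $ 1 = -c" "E a b c t $ 2 $ 2 = 1" "E a b c t $ 2 $ 3 = 0" "E a b c t $ 2 $ 4 = 0"
  "E a b c t $ 3 $ 1 = b - c * t" "E a b c t $ 3 $ 2 = t" "E a b c t $ 3 $ 3 = 1" "E a b c t $ 3 $ 4 = 0"
  "E a b c t $ 4 $ 1 = a" "E a b c t $ 4 $ 2 = b" "E a b c t $ 4 $ 3 = c" "E a b c t $ 4 $ 4 = 1"
  by (simp_all add: E_def vector_def)

end

theory Submission
  imports "HOL-Number_Theory.Residues" Defs
begin

text \<open>
  The elements of \<open>G\<close> with trivial automorphism form the kernel of the exponent of \<open>g\<close>, a
  homomorphism to \<open>\<bbbF>\<^sub>p\<close>; on this kernel \<open>c\<close> is a homomorphism to \<open>\<bbbF>\<^sub>q\<close>, with kernel \<open>J\<close>. So an abelian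
  subgroup \<open>A\<close> has order \<open>|exponent(A)| |c(A \<inter> ker)| |A \<inter> J|\<close>, and \<open>A = J\<close> gives at least \<open>q\<^sup>2/p\<close>.

  Two commuting elements with trivial automorphism satisfy \<open>c\<^sub>1 S\<^sub>1(c\<^sub>2) = c\<^sub>2 S\<^sub>1(c\<^sub>1)\<close>. If some \<open>c\<^sub>1\<close> is
  nonzero, the values \<open>c\<^sub>2\<close> are roots of \<open>c\<^sub>1 S\<^sub>1 - S\<^sub>1(c\<^sub>1) X\<close>, so the second factor is at most
  \<open>deg S\<^sub>1 < q/p\<close>. An element \<open>(a, b, 0)\<close> of \<open>J\<close> that commutes with an element with coordinate \<open>c\<^sub>1\<close> and
  automorphism \<open>\<sigma>\<close> satisfies \<open>\<sigma> b = b\<close> and \<open>\<sigma> a = a + 2 c\<^sub>1 b\<close>. If \<open>\<sigma> = 1\<close> and \<open>c\<^sub>1 \<noteq> 0\<close>, then \<open>b = 0\<close>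
  and the third factor is at most \<open>q\<close>. If \<open>\<sigma> \<noteq> 1\<close>, its fixed field is \<open>\<bbbF>\<^bsub>p^l\<^esub>\<close> and the third factor
  is at most \<open>p\<^bsup>2l\<^esup> \<le> q/p\<close>. In both cases \<open>|A| < q\<^sup>2/p\<close> unless \<open>A\<close> lies in \<open>J\<close>.
\<close>


section \<open>Finite groups\<close>

lemma (in group_hom) card_image_times_card_kernel:
  "card (h ` carrier G) * card (kernel G H h) = card (carrier G)"
proof -
  interpret onto_image: group_hom G "H\<lparr>carrier := h ` carrier G\<rparr>" h
    using img_is_subgroup H.subgroup_imp_group
    by (auto simp: group_hom_def group_hom_axioms_def hom_def)
  have kernel: "kernel G (H\<lparr>carrier := h ` carrier G\<rparr>) h = kernel G H h"
    by (simp add: kernel_def)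
  have "(\<lambda>X. the_elem (h ` X)) \<in> iso (G Mod kernel G H h) (H\<lparr>carrier := h ` carrier G\<rparr>)"
    using onto_image.FactGroup_iso_set by (simp add: kernel)
  then have "card (rcosets kernel G H h) = card (h ` carrier G)"
    using bij_betw_same_card by (fastforce simp: iso_def FactGroup_def)
  then show ?thesis
    using G.lagrange[OF subgroup_kernel] by (simp add: Coset.order_def)
qed

definition additive_group :: "'a::ab_group_add monoid" where
  "additive_group = \<lparr>carrier = UNIV, monoid.mult = (+), one = 0\<rparr>"

lemma group_additive_group: "group (additive_group :: 'a::ab_group_add monoid)"
  by (rule groupI) (auto simp: additive_group_def add.assoc intro: exI[of _ "- x" for x])

lemma (in additive) card_range_times_card_kernel:
  "card (range f) * card {x. f x = 0} = CARD('a)"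
proof -
  interpret group_hom additive_group additive_group f
    by (simp add: group_hom_def group_hom_axioms_def group_additive_group)
      (simp add: hom_def additive_group_def add)
  show ?thesis
    using card_image_times_card_kernel by (simp add: kernel_def additive_group_def)
qed

context group
begin

context
  fixes A :: "'a set" and f :: "'a \<Rightarrow> 'c::ab_group_add"
  assumes subgroup: "subgroup A G"
    and additive: "\<And>x y. x \<in> A \<Longrightarrow> y \<in> A \<Longrightarrow> f (x \<otimes> y) = f x + f y"
begin

interpretation hom: group_hom "G\<lparr>carrier := A\<rparr>" additive_group f
  using subgroup_imp_group[OF subgroup]
  by (simp add: group_hom_def group_hom_axioms_def group_additive_group)
    (simp add: hom_def additive_group_def additive)

lemma subgroup_additive_kernel: "subgroup {x \<in> A. f x = 0} G"
  using incl_subgroup[OF subgroup hom.subgroup_kernel] by (simp add: kernel_def additive_group_def)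

lemma card_subgroup_eq_image_times_kernel: "card A = card (f ` A) * card {x \<in> A. f x = 0}"
  using hom.card_image_times_card_kernel by (simp add: kernel_def additive_group_def)

end

lemma abelian_subgroup_iff:
  "abelian_subgroup G A \<longleftrightarrow> subgroup A G \<and> (\<forall>x\<in>A. \<forall>y\<in>A. x \<otimes> y = y \<otimes> x)"
proof (cases "subgroup A G")
  case True
  then interpret A: group "G\<lparr>carrier := A\<rparr>"
    by (rule subgroup_imp_group)
  have "comm_group (G\<lparr>carrier := A\<rparr>) \<longleftrightarrow> (\<forall>x\<in>A. \<forall>y\<in>A. x \<otimes> y = y \<otimes> x)"
    using A.group_comm_groupI comm_groupE(4)[of "G\<lparr>carrier := A\<rparr>"] by auto
  with True show ?thesis
    by (simp add: abelian_subgroup_def)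
qed (simp add: abelian_subgroup_def)

lemma thompson_subgroup_eqI:
  assumes J: "abelian_subgroup G J" "finite J"
    and less: "\<And>A. abelian_subgroup G A \<Longrightarrow> \<not> A \<subseteq> J \<Longrightarrow> card A < card J"
  shows "thompson_subgroup G = J"
proof -
  have "card A \<le> card J" if "abelian_subgroup G A" for A
    using less[OF that] card_mono[OF J(2)] by fastforce
  moreover have "A = J" if "abelian_subgroup G A" "card J \<le> card A" for A
    using less[OF that(1)] card_seteq[OF J(2) _ that(2)] that(2) by fastforce
  ultimately have "max_order_abelian_subgroups G = {J}"
    using J(1) unfolding max_order_abelian_subgroups_def by blast
  moreover have "generate G J = J"
    using J(1) generateI[of J J] by (simp add: abelian_subgroup_def)
  ultimately show ?thesis
    by (simp add: thompson_subgroup_def)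
qed

end


section \<open>Fields and their endomorphisms\<close>

lemma power_CARD_eq_same: "x ^ CARD('a) = (x::'a::{field, finite})"
proof (cases "x = 0")
  case False
  define P where "P = (\<Prod>y\<in>-{0::'a}. y)"
  have "P = (\<Prod>y\<in>-{0}. x * y)"
    unfolding P_def
    by (rule prod.reindex_bij_witness[of _ "\<lambda>y. x * y" "\<lambda>y. y / x"]) (use False in auto)
  also have "\<dots> = x ^ (CARD('a) - 1) * P"
    by (simp add: prod.distrib P_def Compl_eq_Diff_UNIV)
  finally have "x ^ (CARD('a) - 1) = 1"
    by (simp add: P_def)
  then show ?thesis
    using power_Suc[of x "CARD('a) - 1"] by (simp add: finite_UNIV_card_ge_0)
qed (simp add: finite_UNIV_card_ge_0)

lemma card_power_eq_self_le:
  fixes n :: nat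
  assumes "n > 1"
  shows "card {x::'a::idom. x ^ n = x} \<le> n"
proof -
  define f :: "'a poly" where "f = monom 1 n - monom 1 1"
  have "coeff f n = 1"
    using assms by (simp add: f_def)
  then have "f \<noteq> 0"
    by force
  have "card {x::'a. x ^ n = x} = card {x. poly f x = 0}"
    by (simp add: f_def poly_monom)
  also have "\<dots> \<le> degree f"
    using \<open>f \<noteq> 0\<close> by (rule card_poly_roots_bound)
  also have "\<dots> \<le> n"
    unfolding f_def using assms by (intro degree_diff_le) (auto simp: degree_monom_eq)
  finally show ?thesis .
qed

lemma card_le_degree_if_proportional_values:
  fixes f :: "'a::idom poly"
  assumes "1 < degree f" and proportional: "\<And>x y. x \<in> X \<Longrightarrow> y \<in> X \<Longrightarrow> x * poly f y = y * poly f x"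
  shows "card X \<le> degree f"
proof (cases "X \<subseteq> {0}")
  case True
  then have "card X \<le> card {0::'a}"
    by (intro card_mono) auto
  then show ?thesis
    using assms(1) by simp
next
  case False
  then obtain c where c: "c \<in> X" "c \<noteq> 0"
    by blast
  define h where "h = smult c f - monom (poly f c) 1"
  have "degree (monom (poly f c) 1) < degree (smult c f)"
    using assms(1) c(2) degree_monom_le[of "poly f c" 1] by simp
  then have degree_h: "degree h = degree f"
    unfolding h_def diff_conv_add_uminus using c(2) by (subst degree_add_eq_left) auto
  then have "h \<noteq> 0"
    using assms(1) by auto
  have "X \<subseteq> {x. poly h x = 0}"
    using proportional[OF c(1)] by (auto simp: h_def poly_monom mult.commute)
  then have "card X \<le> card {x. poly h x = 0}"
    using \<open>h \<noteq> 0\<close> by (intro card_mono poly_roots_finite)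
  also have "\<dots> \<le> degree f"
    using card_poly_roots_bound[OF \<open>h \<noteq> 0\<close>] by (simp add: degree_h)
  finally show ?thesis .
qed

locale field_endomorphism = additive \<sigma> for \<sigma> :: "'a::field \<Rightarrow> 'a" +
  assumes one: "\<sigma> 1 = 1" and mult: "\<sigma> (x * y) = \<sigma> x * \<sigma> y"
begin

lemma inj: "inj \<sigma>"
proof (rule injI)
  fix x y assume "\<sigma> x = \<sigma> y"
  then have "\<sigma> (x - y) = 0"
    by (simp add: diff)
  show "x = y"
  proof (rule ccontr)
    assume "x \<noteq> y"
    then have "\<sigma> (x - y) * \<sigma> (1 / (x - y)) = 1"
      by (simp flip: mult add: one)
    then show False
      using \<open>\<sigma> (x - y) = 0\<close> by simp
  qed
qed

lemma surj_if_finite: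
  assumes "finite (UNIV :: 'a set)"
  shows "surj \<sigma>"
  using assms inj by (rule finite_UNIV_inj_surj)

lemma map_matrix_mult:
  "map_matrix \<sigma> (A ** B) = map_matrix \<sigma> A ** map_matrix \<sigma> (B :: 'a^'n^'m)"
  by (simp add: vec_eq_iff matrix_matrix_mult_def sum mult)

lemma map_matrix_E_mult:
  "map_matrix \<sigma> (E a1 b1 c1 t1) ** E a2 b2 c2 t2 =
    E (\<sigma> a1 + a2 - \<sigma> b1 * c2 + \<sigma> c1 * b2 - \<sigma> c1 * c2 * t2) (\<sigma> b1 + b2 + \<sigma> c1 * t2)
      (\<sigma> c1 + c2) (\<sigma> t1 + t2)"
  unfolding vec_eq_iff forall_4
  by (simp add: matrix_matrix_mult_def sum_4 E_nth zero one add minus diff mult algebra_simps)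

end

lemma E_eq_mat_1: "E 0 0 0 0 = mat 1"
  unfolding vec_eq_iff forall_4 by (simp add: E_nth mat_def)

lemma pair_mult_assoc:
  fixes x y z :: "'a::field sl_pair"
  assumes "field_endomorphism (snd z)"
  shows "pair_mult (pair_mult x y) z = pair_mult x (pair_mult y z)"
proof -
  have comp: "map_matrix f (map_matrix g A) = map_matrix (f \<circ> g) A"
    for f g :: "'a \<Rightarrow> 'a" and A :: "'a^4^4"
    by (simp add: vec_eq_iff)
  show ?thesis
    by (cases x; cases y; cases z)
      (use assms in \<open>simp add: comp field_endomorphism.map_matrix_mult matrix_mul_assoc comp_assoc\<close>)
qed


section \<open>Frobenius, trace and linearized polynomials\<close>

lemma funpow_frob: "(frob p l ^^ n) x = x ^ p ^ (l * n)"
  by (induction n) (simp_all add: frob_def power_add mult.commute flip: power_mult)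

lemma poly_lin_poly: "poly (lin_poly p l s) x = (\<Sum>i<p * l. s i * x ^ p ^ i)"
  by (simp add: lin_poly_def poly_sum poly_monom)

lemma tr_mult_eq_poly_lin_poly: "tr p l (a * x) = poly (lin_poly p l (\<lambda>i. a ^ p ^ i)) x"
  by (simp add: poly_lin_poly tr_def power_mult_distrib)

locale frobenius_field =
  fixes p l :: nat and field_type :: "'a::{field, finite} itself"
  assumes prime_p: "prime p" and l_pos: "l > 0" and CARD_eq: "CARD('a) = p ^ (p * l)"
begin

lemma p_gt_1: "p > 1"
  using prime_p by (rule prime_gt_1_nat)

lemma CHAR_eq: "CHAR('a) = p"
proof -
  have prime_CHAR: "prime CHAR('a)"
    by (intro prime_CHAR_semidom finite_imp_CHAR_pos) simp
  have "CHAR('a) dvd p ^ (p * l)"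
    using CHAR_dvd_CARD[where 'a = 'a] by (simp add: CARD_eq)
  then have "CHAR('a) dvd p"
    using prime_CHAR prime_dvd_power by blast
  then show ?thesis
    using prime_CHAR prime_p primes_dvd_imp_eq by blast
qed

lemma power_CARD: "x ^ p ^ (p * l) = (x::'a)"
  using power_CARD_eq_same[of x] by (simp add: CARD_eq)

sublocale power_p: field_endomorphism "\<lambda>x::'a. x ^ p ^ i" for i :: nat
proof
  show "(x + y) ^ p ^ i = x ^ p ^ i + y ^ p ^ i" for x y :: 'a
    by (rule freshmans_dream') (use prime_p CHAR_eq in auto)
qed (simp_all add: power_mult_distrib)

sublocale frob: field_endomorphism "frob p l ^^ n :: 'a \<Rightarrow> 'a" for n :: nat
  using power_p.field_endomorphism_axioms[of "l * n"] by (simp add: funpow_frob[abs_def])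

lemma funpow_frob_p: "frob p l ^^ p = (id :: 'a \<Rightarrow> 'a)"
  by (simp add: fun_eq_iff funpow_frob power_CARD mult.commute[of l])

lemma funpow_frob_cong:
  assumes "[m = n] (mod p)"
  shows "frob p l ^^ m = (frob p l ^^ n :: 'a \<Rightarrow> 'a)"
proof
  fix x :: 'a
  have "(frob p l ^^ (k mod p)) x = (frob p l ^^ k) x" for k
    by (rule funpow_mod_eq) (simp add: funpow_frob_p)
  then show "(frob p l ^^ m) x = (frob p l ^^ n) x"
    using assms unfolding cong_def by metis
qed

lemma card_subset_Fpl_le:
  assumes "k > 0" "X \<subseteq> (Fpl p k :: 'a set)"
  shows "card X \<le> p ^ k"
proof -
  have "card X \<le> card (Fpl p k :: 'a set)"
    using assms(2) by (intro card_mono) auto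
  also have "\<dots> \<le> p ^ k"
    unfolding Fpl_def using p_gt_1 assms(1) by (intro card_power_eq_self_le one_less_power)
  finally show ?thesis .
qed

lemma funpow_frob_Fpl:
  assumes "x \<in> Fpl p l"
  shows "(frob p l ^^ n) x = (x::'a)"
  using assms by (induction n) (simp_all add: Fpl_def frob_def)

lemma Fpl_add: "x \<in> Fpl p k \<Longrightarrow> y \<in> Fpl p k \<Longrightarrow> x + y \<in> (Fpl p k :: 'a set)"
  and Fpl_minus: "x \<in> Fpl p k \<Longrightarrow> - x \<in> (Fpl p k :: 'a set)"
  and Fpl_divide: "x \<in> Fpl p k \<Longrightarrow> y \<in> Fpl p k \<Longrightarrow> x / y \<in> (Fpl p k :: 'a set)"
  by (simp_all add: Fpl_def power_p.add power_p.minus power_divide)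

lemma of_nat_in_Fpl: "of_nat n \<in> (Fpl p k :: 'a set)"
  by (induction n) (simp_all add: Fpl_def power_p.add power_p.zero)

lemma of_nat_eq_iff_cong: "(of_nat m :: 'a) = of_nat n \<longleftrightarrow> [m = n] (mod p)"
  using of_nat_eq_iff_cong_CHAR[where 'a = 'a] by (simp add: CHAR_eq)

lemma two_neq_0:
  assumes "odd p"
  shows "(2::'a) \<noteq> 0"
proof -
  have "\<not> [2 = 0] (mod p)"
    using assms primes_dvd_imp_eq[OF prime_p two_is_prime_nat] by (auto simp: cong_0_iff)
  then show ?thesis
    using of_nat_eq_iff_cong[of 2 0] by simp
qed

lemma prime_field_eq: "Fpl p 1 = (of_nat ` {..<p} :: 'a set)"
proof -
  have "card (of_nat ` {..<p} :: 'a set) = p"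
    by (subst card_image) (auto simp: inj_on_def of_nat_eq_iff_cong cong_def)
  then have "of_nat ` {..<p} = (Fpl p 1 :: 'a set)"
    using card_subset_Fpl_le[of 1] of_nat_in_Fpl by (intro card_seteq) auto
  then show ?thesis
    by simp
qed

sublocale frob_pow: field_endomorphism "frob_pow p l e :: 'a \<Rightarrow> 'a" for e
  unfolding frob_pow_def by (rule frob.field_endomorphism_axioms)

lemma frob_pow_of_nat: "frob_pow p l (of_nat n) = (frob p l ^^ n :: 'a \<Rightarrow> 'a)"
proof -
  have "of_nat (LEAST m. of_nat m = (of_nat n :: 'a)) = (of_nat n :: 'a)"
    by (rule LeastI[of _ n]) simp
  then show ?thesis
    unfolding frob_pow_def of_nat_eq_iff_cong by (rule funpow_frob_cong)
qed

lemma frob_pow_0: "frob_pow p l 0 = (id :: 'a \<Rightarrow> 'a)"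
  using frob_pow_of_nat[of 0] by (simp add: id_def)

lemma frob_pow_add:
  fixes e f :: 'a
  assumes "e \<in> Fpl p 1" "f \<in> Fpl p 1"
  shows "frob_pow p l (e + f) = frob_pow p l f \<circ> frob_pow p l e"
proof -
  obtain m n where "e = of_nat m" "f = of_nat n"
    using assms unfolding prime_field_eq by blast
  then show ?thesis
    using funpow_add[of n m "frob p l"] by (simp add: frob_pow_of_nat add.commute[of n] flip: of_nat_add)
qed

lemma frob_pow_fixed:
  fixes e x :: 'a
  assumes e: "e \<in> Fpl p 1" "e \<noteq> 0" and fixed: "frob_pow p l e x = x"
  shows "x \<in> Fpl p l"
proof -
  obtain n where n: "e = of_nat n"
    using e(1) unfolding prime_field_eq by blast
  then have "\<not> p dvd n"
    using e(2) by (simp add: of_nat_eq_0_iff_char_dvd CHAR_eq)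
  then have "coprime n p"
    using prime_p prime_imp_coprime coprime_commute by blast
  then obtain m where m: "[n * m = 1] (mod p)"
    using cong_solve_coprime_nat by (metis One_nat_def)
  have "((frob p l ^^ n) ^^ m) x = x"
    using fixed by (induction m) (simp_all add: n frob_pow_of_nat)
  then have "(frob p l ^^ (n * m)) x = x"
    by (simp add: funpow_mult mult.commute)
  then show ?thesis
    using funpow_frob_cong[OF m] by (simp add: Fpl_def frob_def)
qed

lemma frob_pow_eq_id_iff:
  assumes "(e::'a) \<in> Fpl p 1"
  shows "frob_pow p l e = id \<longleftrightarrow> e = 0"
proof
  assume id: "frob_pow p l e = id"
  show "e = 0"
  proof (rule ccontr)
    assume "e \<noteq> 0"
    then have "Fpl p l = (UNIV :: 'a set)"
      using frob_pow_fixed[OF assms] id by auto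
    then have "p ^ (p * l) \<le> p ^ l"
      using card_subset_Fpl_le[OF l_pos, of UNIV] CARD_eq by simp
    then have "p * l \<le> l"
      using p_gt_1 by (simp only: power_increasing_iff)
    then show False
      using p_gt_1 l_pos by simp
  qed
qed (simp add: frob_pow_0)

lemma additive_lin_poly: "additive (poly (lin_poly p l s) :: 'a \<Rightarrow> 'a)"
  by standard (simp add: poly_lin_poly power_p.add distrib_left sum.distrib)

lemma card_lin_poly_roots_le:
  fixes s :: "nat \<Rightarrow> 'a"
  assumes "i < p * l" "s i \<noteq> 0"
  shows "card {x. poly (lin_poly p l s) x = 0} \<le> p ^ (p * l - 1)"
proof -
  have "coeff (lin_poly p l s) (p ^ i) = (\<Sum>j<p * l. if j = i then s i else 0)"
    unfolding lin_poly_def coeff_sum using p_gt_1 by (intro sum.cong) auto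
  then have "lin_poly p l s \<noteq> 0"
    using assms by (auto dest: arg_cong[where f = "\<lambda>f. coeff f (p ^ i)"])
  then have "card {x. poly (lin_poly p l s) x = 0} \<le> degree (lin_poly p l s)"
    by (rule card_poly_roots_bound)
  also have "\<dots> \<le> p ^ (p * l - 1)"
    unfolding lin_poly_def
    by (rule degree_sum_le) (use p_gt_1 in \<open>auto intro!: order.trans[OF degree_monom_le]\<close>)
  finally show ?thesis .
qed

sublocale tr: additive "tr p l :: 'a \<Rightarrow> 'a"
  using additive_lin_poly[of "\<lambda>i. 1"] tr_mult_eq_poly_lin_poly[of p l "1::'a"]
  by (simp add: additive_def)

lemma tr_power_p: "tr p l (x ^ p ^ i :: 'a) = tr p l x"
proof -
  have "tr p l (x ^ p) = tr p l x" for x :: 'a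
  proof -
    have "tr p l x + x = (\<Sum>i<Suc (p * l). x ^ p ^ i)"
      by (simp add: tr_def power_CARD)
    also have "\<dots> = x + tr p l (x ^ p)"
      unfolding sum.lessThan_Suc_shift by (simp add: tr_def power_mult)
    finally show ?thesis
      by simp
  qed
  then show ?thesis
    by (induction i) (simp_all add: power_mult mult.commute[of p])
qed

lemma tr_in_prime_field: "tr p l x \<in> (Fpl p 1 :: 'a set)"
proof -
  have "tr p l x ^ p ^ 1 = tr p l (x ^ p ^ 1)"
    unfolding tr_def power_p.sum by (simp add: mult.commute flip: power_mult)
  then show ?thesis
    unfolding tr_power_p by (simp add: Fpl_def)
qed

lemma tr_mult_funpow_frob:
  assumes "\<mu> \<in> Fpl p l"
  shows "tr p l (\<mu> * (frob p l ^^ n) x) = tr p l (\<mu> * x :: 'a)"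
proof -
  have "\<mu> * (frob p l ^^ n) x = (frob p l ^^ n) (\<mu> * x)"
    by (simp add: frob.mult funpow_frob_Fpl[OF assms])
  then show ?thesis
    by (simp add: funpow_frob tr_power_p)
qed

lemma CARD_le_card_tr_kernel: "CARD('a) \<le> p * card {x. tr p l (\<mu> * x) = (0::'a)}"
proof -
  interpret additive "\<lambda>x. tr p l (\<mu> * x)"
    by (simp add: additive_def distrib_left tr.add)
  have "card (range (\<lambda>x. tr p l (\<mu> * x))) \<le> p"
    using card_subset_Fpl_le[of 1] tr_in_prime_field by (simp add: image_subset_iff)
  then show ?thesis
    by (metis card_range_times_card_kernel mult_le_mono1)
qed

lemma card_tr_kernel:
  assumes "\<mu> \<noteq> (0::'a)"
  shows "p * card {x. tr p l (\<mu> * x) = 0} = CARD('a)"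
proof (rule antisym)
  have "card {x. tr p l (\<mu> * x) = 0} \<le> p ^ (p * l - 1)"
    using card_lin_poly_roots_le[of 0 "\<lambda>i. \<mu> ^ p ^ i"] assms p_gt_1 l_pos
    by (simp add: tr_mult_eq_poly_lin_poly)
  then show "p * card {x. tr p l (\<mu> * x) = 0} \<le> CARD('a)"
    using p_gt_1 l_pos by (simp add: CARD_eq power_eq_if[of p "p * l"])
qed (rule CARD_le_card_tr_kernel)

end


section \<open>Groups twisted by a Frobenius exponent\<close>

locale frobenius_lin_poly = frobenius_field p l "TYPE('a)"
  for p l :: nat and s :: "nat \<Rightarrow> 'a::{field, finite}" +
  assumes s_in_Fpl: "i < p * l \<Longrightarrow> s i \<in> Fpl p l"
begin

abbreviation S :: "'a \<Rightarrow> 'a" where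
  "S \<equiv> poly (lin_poly p l s)"

sublocale S: additive S
  by (rule additive_lin_poly)

lemma S_funpow_frob: "S ((frob p l ^^ n) x) = (frob p l ^^ n) (S x)"
proof -
  have "(frob p l ^^ n) (s i * x ^ p ^ i) = s i * (frob p l ^^ n) x ^ p ^ i" if "i < p * l" for i
    by (simp add: frob.mult funpow_frob_Fpl s_in_Fpl that)
      (simp add: funpow_frob mult.commute flip: power_mult)
  then show ?thesis
    by (simp add: poly_lin_poly frob.sum)
qed

end

text \<open>
  In both constructions \<open>\<theta>\<^bsub>a,b,c\<^esub>\<close> is a power of \<open>g\<close> whose exponent \<open>e b c\<close> does not depend on \<open>a\<close>;
  \<open>e_twisted_add\<close> says that the exponent is additive along the group multiplication.
\<close>

locale frobenius_twisted_group = frobenius_lin_poly p l s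
  for p l :: nat and s :: "nat \<Rightarrow> 'a::{field, finite}" +
  fixes e :: "'a \<Rightarrow> 'a \<Rightarrow> 'a"
  assumes e_in_prime_field: "e b c \<in> Fpl p 1"
    and e_twisted_add:
      "e ((frob p l ^^ n) b1 + b2 + (frob p l ^^ n) c1 * S c2) ((frob p l ^^ n) c1 + c2) =
        e b1 c1 + e b2 c2"
begin

abbreviation elem :: "'a \<Rightarrow> 'a \<Rightarrow> 'a \<Rightarrow> 'a sl_pair" where
  "elem \<equiv> gelem (T_S1 p l s) (\<lambda>a b c. frob_pow p l (e b c))"

abbreviation G :: "'a sl_pair monoid" where
  "G \<equiv> ggroup (T_S1 p l s) (\<lambda>a b c. frob_pow p l (e b c))"

definition coord_a :: "'a sl_pair \<Rightarrow> 'a" where "coord_a x = fst x $ 4 $ 1"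
definition coord_b :: "'a sl_pair \<Rightarrow> 'a" where "coord_b x = fst x $ 4 $ 2"
definition coord_c :: "'a sl_pair \<Rightarrow> 'a" where "coord_c x = fst x $ 4 $ 3"

definition exponent :: "'a sl_pair \<Rightarrow> 'a" where
  "exponent x = e (coord_b x) (coord_c x)"

lemma coords_elem [simp]:
  "coord_a (elem a b c) = a" "coord_b (elem a b c) = b" "coord_c (elem a b c) = c"
  by (simp_all add: coord_a_def coord_b_def coord_c_def gelem_def E_nth)

lemma exponent_elem [simp]: "exponent (elem a b c) = e b c"
  by (simp add: exponent_def)

lemma carrier_G: "carrier G = {elem a b c | a b c. True}"
  by (simp add: ggroup_def)

lemma elem_in_carrier [simp]: "elem a b c \<in> carrier G"
  by (auto simp: carrier_G)

lemma elem_coords: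
  assumes "x \<in> carrier G"
  shows "elem (coord_a x) (coord_b x) (coord_c x) = x"
  using assms by (auto simp: carrier_G)

lemma carrier_eqI:
  assumes "x \<in> carrier G" "y \<in> carrier G"
    and "coord_a x = coord_a y" "coord_b x = coord_b y" "coord_c x = coord_c y"
  shows "x = y"
  using assms elem_coords by metis

lemma finite_carrier: "finite (carrier G)"
proof -
  have "inj_on (\<lambda>x. (coord_a x, coord_b x, coord_c x)) (carrier G)"
    by (intro inj_onI carrier_eqI) simp_all
  then show ?thesis
    by (rule inj_on_finite) auto
qed

lemma e_0: "e 0 0 = 0"
proof -
  have "e 0 0 + e 0 0 = e 0 0 + 0"
    using e_twisted_add[of 0 0 0 0 0] by (simp only: S.zero frob.zero add_0_right mult_zero_right)
  then show ?thesis
    by (rule add_left_imp_eq)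
qed

lemma elem_mult:
  fixes a1 b1 c1 a2 b2 c2 :: 'a
  defines "\<sigma> \<equiv> frob_pow p l (e b2 c2)"
  shows "elem a1 b1 c1 \<otimes>\<^bsub>G\<^esub> elem a2 b2 c2 =
    elem (\<sigma> a1 + a2 - \<sigma> b1 * c2 + \<sigma> c1 * b2 - \<sigma> c1 * c2 * S c2) (\<sigma> b1 + b2 + \<sigma> c1 * S c2) (\<sigma> c1 + c2)"
proof -
  obtain n where n: "\<sigma> = frob p l ^^ n"
    by (simp add: \<sigma>_def frob_pow_def)
  have "frob_pow p l (e (\<sigma> b1 + b2 + \<sigma> c1 * S c2) (\<sigma> c1 + c2)) = \<sigma> \<circ> frob_pow p l (e b1 c1)"
    unfolding n e_twisted_add frob_pow_add[OF e_in_prime_field e_in_prime_field]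
    by (simp add: \<sigma>_def flip: n)
  moreover have "\<sigma> (S c1) + S c2 = S (\<sigma> c1 + c2)"
    by (simp add: n S.add S_funpow_frob)
  ultimately show ?thesis
    using frob_pow.map_matrix_E_mult[of "e b2 c2" a1 b1 c1 "S c1" a2 b2 c2 "S c2"]
    by (simp add: ggroup_def gelem_def T_S1_def flip: \<sigma>_def)
qed

lemma one_eq_elem: "\<one>\<^bsub>G\<^esub> = elem 0 0 0"
  by (simp add: ggroup_def gelem_def T_S1_def S.zero E_eq_mat_1 e_0 frob_pow_0)

lemma left_inverse_elem: "\<exists>y\<in>carrier G. y \<otimes>\<^bsub>G\<^esub> elem a b c = \<one>\<^bsub>G\<^esub>"
proof -
  have surj: "\<exists>y. frob_pow p l (e b c) y = x" for x
    using frob_pow.surj_if_finite[of "e b c"] by (metis finite surjD)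
  obtain c' where c': "frob_pow p l (e b c) c' = - c"
    using surj by blast
  obtain b' where b': "frob_pow p l (e b c) b' = - b + c * S c"
    using surj by blast
  obtain a' where a': "frob_pow p l (e b c) a' = - a + (- b + c * S c) * c + c * b - c * c * S c"
    using surj by blast
  have "elem a' b' c' \<otimes>\<^bsub>G\<^esub> elem a b c = \<one>\<^bsub>G\<^esub>"
    by (simp add: elem_mult one_eq_elem a' b' c')
  then show ?thesis
    using elem_in_carrier by blast
qed

sublocale group G
proof (rule groupI)
  show "x \<otimes>\<^bsub>G\<^esub> y \<in> carrier G" if "x \<in> carrier G" "y \<in> carrier G" for x y
    using that by (metis elem_coords elem_mult elem_in_carrier)
  show "x \<otimes>\<^bsub>G\<^esub> y \<otimes>\<^bsub>G\<^esub> z = x \<otimes>\<^bsub>G\<^esub> (y \<otimes>\<^bsub>G\<^esub> z)"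
    if "x \<in> carrier G" "y \<in> carrier G" "z \<in> carrier G" for x y z
    using pair_mult_assoc[of z x y] that frob_pow.field_endomorphism_axioms
    by (auto simp: ggroup_def gelem_def)
  show "\<one>\<^bsub>G\<^esub> \<otimes>\<^bsub>G\<^esub> x = x" if "x \<in> carrier G" for x
    using that by (auto simp: carrier_G one_eq_elem elem_mult frob_pow.zero)
  show "\<exists>y\<in>carrier G. y \<otimes>\<^bsub>G\<^esub> x = \<one>\<^bsub>G\<^esub>" if "x \<in> carrier G" for x
    using that left_inverse_elem by (auto simp: carrier_G)
qed (simp add: one_eq_elem)

lemma coords_mult:
  assumes "x \<in> carrier G" "y \<in> carrier G"
  defines "\<sigma> \<equiv> frob_pow p l (exponent y)"
  shows "coord_a (x \<otimes>\<^bsub>G\<^esub> y) = \<sigma> (coord_a x) + coord_a y - \<sigma> (coord_b x) * coord_c y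
           + \<sigma> (coord_c x) * coord_b y - \<sigma> (coord_c x) * coord_c y * S (coord_c y)"
    and "coord_b (x \<otimes>\<^bsub>G\<^esub> y) = \<sigma> (coord_b x) + coord_b y + \<sigma> (coord_c x) * S (coord_c y)"
    and "coord_c (x \<otimes>\<^bsub>G\<^esub> y) = \<sigma> (coord_c x) + coord_c y"
  using assms by (auto simp: carrier_G elem_mult)

lemma exponent_mult:
  assumes "x \<in> carrier G" "y \<in> carrier G"
  shows "exponent (x \<otimes>\<^bsub>G\<^esub> y) = exponent x + exponent y"
proof -
  obtain n where "frob_pow p l (exponent y) = frob p l ^^ n"
    by (simp add: frob_pow_def)
  then show ?thesis
    using assms
    by (simp add: exponent_def[of "x \<otimes>\<^bsub>G\<^esub> y"] exponent_def[of x] coords_mult e_twisted_add)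
      (simp add: exponent_def)
qed

definition linear_part :: "'a sl_pair set" where
  "linear_part = {x \<in> carrier G. exponent x = 0}"

definition J :: "'a sl_pair set" where
  "J = {x \<in> linear_part. coord_c x = 0}"

lemma linear_part_subset: "linear_part \<subseteq> carrier G" and J_subset: "J \<subseteq> linear_part"
  by (auto simp: linear_part_def J_def)

lemma J_eqI:
  assumes "x \<in> J" "y \<in> J" "coord_a x = coord_a y" "coord_b x = coord_b y"
  shows "x = y"
  using assms by (intro carrier_eqI) (simp_all add: J_def linear_part_def)

lemma coords_mult_linear_part:
  assumes "x \<in> carrier G" "y \<in> linear_part"
  shows "coord_b (x \<otimes>\<^bsub>G\<^esub> y) = coord_b x + coord_b y + coord_c x * S (coord_c y)"
    and "coord_c (x \<otimes>\<^bsub>G\<^esub> y) = coord_c x + coord_c y"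
  using assms by (simp_all add: linear_part_def coords_mult frob_pow_0)

lemma subgroup_linear_part: "subgroup linear_part G"
  unfolding linear_part_def by (rule subgroup_additive_kernel[OF subgroup_self exponent_mult])

lemma subgroup_J: "subgroup J G"
  unfolding J_def using linear_part_subset
  by (intro subgroup_additive_kernel[OF subgroup_linear_part]) (auto intro: coords_mult_linear_part)

lemma abelian_subgroup_J: "abelian_subgroup G J"
proof -
  have "x \<otimes>\<^bsub>G\<^esub> y = y \<otimes>\<^bsub>G\<^esub> x" if "x \<in> J" "y \<in> J" for x y
    using that by (intro carrier_eqI) (auto simp: J_def linear_part_def coords_mult frob_pow_0 S.zero)
  then show ?thesis
    using subgroup_J by (simp add: abelian_subgroup_iff)
qed

lemma J_eq: "J = {elem a b 0 | a b. frob_pow p l (e b 0) = id}"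
proof -
  have "x \<in> J \<longleftrightarrow> (\<exists>a b. x = elem a b 0 \<and> e b 0 = 0)" for x
  proof
    assume "x \<in> J"
    then have "x = elem (coord_a x) (coord_b x) 0" "e (coord_b x) 0 = 0"
      using elem_coords[of x] by (auto simp: J_def linear_part_def exponent_def)
    then show "\<exists>a b. x = elem a b 0 \<and> e b 0 = 0"
      by blast
  qed (auto simp: J_def linear_part_def)
  then show ?thesis
    unfolding frob_pow_eq_id_iff[OF e_in_prime_field] by blast
qed

lemma card_J: "card J = CARD('a) * card {b. e b 0 = 0}"
proof -
  have "bij_betw (\<lambda>x. (coord_a x, coord_b x)) J (UNIV \<times> {b. e b 0 = 0})"
    by (rule bij_betwI[where g = "\<lambda>(a, b). elem a b 0"]) (auto simp: J_def linear_part_def carrier_G)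
  then show ?thesis
    by (simp add: bij_betw_same_card card_cartesian_product)
qed


subsection \<open>Orders of abelian subgroups\<close>

lemma coord_c_proportional_if_commuting:
  assumes "x \<in> linear_part" "y \<in> linear_part" "x \<otimes>\<^bsub>G\<^esub> y = y \<otimes>\<^bsub>G\<^esub> x"
  shows "coord_c x * S (coord_c y) = coord_c y * S (coord_c x)"
  using arg_cong[OF assms(3), of coord_b] assms(1,2) linear_part_subset[THEN subsetD]
  by (simp add: coords_mult_linear_part)

lemma frob_pow_coords_if_commuting_with_J:
  fixes y :: "'a sl_pair"
  assumes "x \<in> J" "y \<in> carrier G" "x \<otimes>\<^bsub>G\<^esub> y = y \<otimes>\<^bsub>G\<^esub> x"
  defines "\<sigma> \<equiv> frob_pow p l (exponent y)"
  shows "\<sigma> (coord_b x) = coord_b x"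
    and "\<sigma> (coord_a x) = coord_a x + 2 * coord_c y * coord_b x"
proof -
  have x: "x \<in> carrier G" "exponent x = 0" "coord_c x = 0"
    using assms(1) by (auto simp: J_def linear_part_def)
  show b: "\<sigma> (coord_b x) = coord_b x"
    using arg_cong[OF assms(3), of coord_b] x assms(2)
    by (simp add: coords_mult \<sigma>_def frob_pow_0 S.zero frob_pow.zero)
  show "\<sigma> (coord_a x) = coord_a x + 2 * coord_c y * coord_b x"
    using arg_cong[OF assms(3), of coord_a] x assms(2) b
    by (simp add: coords_mult \<sigma>_def frob_pow_0 S.zero frob_pow.zero algebra_simps)
qed

lemma card_abelian_subgroup_le:
  assumes A: "abelian_subgroup G A" and degree: "1 < degree (lin_poly p l s)"
  shows "card A \<le> card (exponent ` A) * (degree (lin_poly p l s) * card (A \<inter> J))"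
proof -
  have subgroup: "subgroup A G"
    and comm: "\<And>x y. x \<in> A \<Longrightarrow> y \<in> A \<Longrightarrow> x \<otimes>\<^bsub>G\<^esub> y = y \<otimes>\<^bsub>G\<^esub> x"
    using A by (auto simp: abelian_subgroup_iff)
  have carrier: "A \<subseteq> carrier G"
    using subgroup by (rule subgroup.subset)
  have "card A = card (exponent ` A) * card {x \<in> A. exponent x = 0}"
    using carrier by (intro card_subgroup_eq_image_times_kernel[OF subgroup] exponent_mult) auto
  also have "{x \<in> A. exponent x = 0} = A \<inter> linear_part"
    using carrier by (auto simp: linear_part_def)
  also have "card (A \<inter> linear_part) =
      card (coord_c ` (A \<inter> linear_part)) * card {x \<in> A \<inter> linear_part. coord_c x = 0}"
    using carrier subgroups_Inter_pair[OF subgroup subgroup_linear_part]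
    by (intro card_subgroup_eq_image_times_kernel coords_mult_linear_part) auto
  also have "{x \<in> A \<inter> linear_part. coord_c x = 0} = A \<inter> J"
    by (auto simp: J_def)
  also have "card (coord_c ` (A \<inter> linear_part)) \<le> degree (lin_poly p l s)"
    using degree comm coord_c_proportional_if_commuting
    by (intro card_le_degree_if_proportional_values) auto
  finally show ?thesis
    by simp
qed

lemma card_le_CARD_if_commuting_in_linear_part:
  assumes K: "K \<subseteq> J" and y: "y \<in> linear_part" "coord_c y \<noteq> 0"
    and comm: "\<And>x. x \<in> K \<Longrightarrow> x \<otimes>\<^bsub>G\<^esub> y = y \<otimes>\<^bsub>G\<^esub> x" and "odd p"
  shows "card K \<le> CARD('a)"
proof -
  have b: "coord_b x = 0" if "x \<in> K" for x
    using frob_pow_coords_if_commuting_with_J(2)[of x y] K y comm that linear_part_subset two_neq_0[OF \<open>odd p\<close>]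
    by (auto simp: linear_part_def frob_pow_0)
  have "inj_on coord_a K"
    using K b by (intro inj_onI J_eqI) auto
  then show ?thesis
    by (rule card_inj_on_le) auto
qed

lemma card_le_if_commuting_outside_linear_part:
  assumes K: "subgroup K G" "K \<subseteq> J" and y: "y \<in> carrier G" "y \<notin> linear_part"
    and comm: "\<And>x. x \<in> K \<Longrightarrow> x \<otimes>\<^bsub>G\<^esub> y = y \<otimes>\<^bsub>G\<^esub> x"
  shows "card K \<le> p ^ (2 * l)"
proof -
  have fixed: "x \<in> Fpl p l" if "frob_pow p l (exponent y) x = x" for x
    using frob_pow_fixed[OF _ _ that] y e_in_prime_field by (simp add: linear_part_def exponent_def)
  have in_J: "x \<in> carrier G" "x \<in> linear_part" "x \<in> J" if "x \<in> K" for x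
    using K(2) that by (auto simp: J_def linear_part_def)
  have "coord_b ` K \<subseteq> Fpl p l"
    using frob_pow_coords_if_commuting_with_J(1)[OF in_J(3) y(1) comm] fixed by auto
  then have image: "card (coord_b ` K) \<le> p ^ l"
    by (rule card_subset_Fpl_le[OF l_pos])
  have "inj_on coord_a {x \<in> K. coord_b x = 0}"
    using K(2) by (intro inj_onI J_eqI) auto
  moreover have "coord_a ` {x \<in> K. coord_b x = 0} \<subseteq> Fpl p l"
    using frob_pow_coords_if_commuting_with_J(2)[OF in_J(3) y(1) comm] fixed by auto
  then have "card (coord_a ` {x \<in> K. coord_b x = 0}) \<le> p ^ l"
    by (rule card_subset_Fpl_le[OF l_pos])
  ultimately have kernel: "card {x \<in> K. coord_b x = 0} \<le> p ^ l"
    by (simp add: card_image)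
  have "card K = card (coord_b ` K) * card {x \<in> K. coord_b x = 0}"
    using in_J K(2)
    by (intro card_subgroup_eq_image_times_kernel[OF K(1)])
      (auto simp: coords_mult_linear_part J_def S.zero)
  also have "\<dots> \<le> p ^ l * p ^ l"
    using image kernel by (rule mult_le_mono)
  finally show ?thesis
    by (simp add: mult_2 power_add)
qed

lemma card_abelian_subgroup_in_linear_part_le:
  assumes A: "abelian_subgroup G A" "A \<subseteq> linear_part" "\<not> A \<subseteq> J"
    and "odd p" and degree: "1 < degree (lin_poly p l s)"
  shows "card A \<le> degree (lin_poly p l s) * CARD('a)"
proof -
  have comm: "x \<otimes>\<^bsub>G\<^esub> y = y \<otimes>\<^bsub>G\<^esub> x" if "x \<in> A" "y \<in> A" for x y
    using A(1) that by (auto simp: abelian_subgroup_iff)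
  have "card (exponent ` A) \<le> card {0::'a}"
    using A(2) by (intro card_mono) (auto simp: linear_part_def)
  moreover obtain y where "y \<in> A" "y \<in> linear_part" "coord_c y \<noteq> 0"
    using A(2,3) by (auto simp: J_def)
  then have "card (A \<inter> J) \<le> CARD('a)"
    by (intro card_le_CARD_if_commuting_in_linear_part[OF _ _ _ comm \<open>odd p\<close>]) auto
  ultimately have "card (exponent ` A) * (degree (lin_poly p l s) * card (A \<inter> J)) \<le>
      1 * (degree (lin_poly p l s) * CARD('a))"
    by (intro mult_le_mono) auto
  then show ?thesis
    using order_trans[OF card_abelian_subgroup_le[OF A(1) degree]] by simp
qed

lemma card_abelian_subgroup_outside_linear_part_le:
  assumes A: "abelian_subgroup G A" "\<not> A \<subseteq> linear_part"
    and degree: "1 < degree (lin_poly p l s)"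
  shows "card A \<le> p * (degree (lin_poly p l s) * p ^ (2 * l))"
proof -
  have subgroup: "subgroup A G"
    and comm: "\<And>x y. x \<in> A \<Longrightarrow> y \<in> A \<Longrightarrow> x \<otimes>\<^bsub>G\<^esub> y = y \<otimes>\<^bsub>G\<^esub> x"
    using A(1) by (auto simp: abelian_subgroup_iff)
  have "exponent ` A \<subseteq> Fpl p 1"
    using e_in_prime_field by (auto simp: exponent_def)
  then have "card (exponent ` A) \<le> p"
    using card_subset_Fpl_le[of 1] by simp
  moreover obtain y where "y \<in> A" "y \<notin> linear_part"
    using A(2) by blast
  then have "card (A \<inter> J) \<le> p ^ (2 * l)"
    using subgroup.mem_carrier[OF subgroup] subgroups_Inter_pair[OF subgroup subgroup_J]
    by (intro card_le_if_commuting_outside_linear_part[OF _ _ _ _ comm]) auto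
  ultimately have "card (exponent ` A) * (degree (lin_poly p l s) * card (A \<inter> J)) \<le>
      p * (degree (lin_poly p l s) * p ^ (2 * l))"
    by (intro mult_le_mono) auto
  then show ?thesis
    by (rule order_trans[OF card_abelian_subgroup_le[OF A(1) degree]])
qed

lemma power_2l_plus_1_le_CARD:
  assumes "odd p"
  shows "p ^ (2 * l + 1) \<le> CARD('a)"
proof -
  have "3 \<le> p"
    using assms p_gt_1 by (cases "p = 2") auto
  have "2 * l + 1 \<le> 3 * l"
    using l_pos by simp
  also have "\<dots> \<le> p * l"
    using \<open>3 \<le> p\<close> by (rule mult_le_mono1)
  finally show ?thesis
    using p_gt_1 by (simp only: CARD_eq power_increasing_iff)
qed

lemma card_abelian_subgroup_less:
  assumes A: "abelian_subgroup G A" "\<not> A \<subseteq> J" and "odd p"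
    and degree: "1 < degree (lin_poly p l s)" "p * degree (lin_poly p l s) < CARD('a)"
  shows "p * card A < CARD('a) ^ 2"
proof -
  have "card A \<le> degree (lin_poly p l s) * CARD('a)"
  proof (cases "A \<subseteq> linear_part")
    case True
    then show ?thesis
      using A \<open>odd p\<close> degree(1) by (intro card_abelian_subgroup_in_linear_part_le)
  next
    case False
    then have "card A \<le> p * (degree (lin_poly p l s) * p ^ (2 * l))"
      using A(1) degree(1) by (intro card_abelian_subgroup_outside_linear_part_le)
    also have "\<dots> = degree (lin_poly p l s) * p ^ (2 * l + 1)"
      by simp
    also have "\<dots> \<le> degree (lin_poly p l s) * CARD('a)"
      using power_2l_plus_1_le_CARD[OF \<open>odd p\<close>] by (rule mult_le_mono2)
    finally show ?thesis .
  qed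
  then have "p * card A \<le> p * degree (lin_poly p l s) * CARD('a)"
    by (simp add: mult.assoc)
  also have "\<dots> < CARD('a) * CARD('a)"
    using degree(2) by simp
  finally show ?thesis
    by (simp add: power2_eq_square)
qed

theorem thompson_subgroup_eq_J:
  assumes "odd p" "1 < degree (lin_poly p l s)" "p * degree (lin_poly p l s) < CARD('a)"
    and kernel: "CARD('a) \<le> p * card {b. e b 0 = 0}"
  shows "thompson_subgroup G = J"
proof (rule thompson_subgroup_eqI[OF abelian_subgroup_J])
  show "finite J"
    using finite_carrier by (rule finite_subset[OF subset_trans[OF J_subset linear_part_subset]])
  show "card A < card J" if "abelian_subgroup G A" "\<not> A \<subseteq> J" for A
  proof -
    have "p * card A < CARD('a) ^ 2"
      using that assms(1-3) by (rule card_abelian_subgroup_less)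
    also have "\<dots> \<le> p * card J"
      using mult_le_mono2[OF kernel, of "CARD('a)"] by (simp add: card_J power2_eq_square mult_ac)
    finally show ?thesis
      by simp
  qed
qed

end


section \<open>Constructions B and C\<close>

locale construction_B = frobenius_lin_poly p l s
  for p l :: nat and s :: "nat \<Rightarrow> 'a::{field, finite}" +
  fixes \<mu> :: 'a
  assumes \<mu>_in_Fpl: "\<mu> \<in> Fpl p l"
begin

sublocale frobenius_twisted_group p l s "\<lambda>b c. tr p l (\<mu> * c)"
proof
  show "tr p l (\<mu> * ((frob p l ^^ n) c1 + c2)) = tr p l (\<mu> * c1) + tr p l (\<mu> * c2)" for n c1 c2
    by (simp add: distrib_left tr.add tr_mult_funpow_frob[OF \<mu>_in_Fpl])
qed (rule tr_in_prime_field)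

lemma elem_B_eq: "elem_B p l \<mu> s = elem"
  and group_B_eq: "group_B p l \<mu> s = G"
  by (simp_all add: elem_B_def group_B_def theta_B_def[abs_def])

theorem thompson_subgroup_group_B:
  assumes "odd p" "1 < degree (lin_poly p l s)" "p * degree (lin_poly p l s) < CARD('a)"
  shows "thompson_subgroup (group_B p l \<mu> s) =
      {elem_B p l \<mu> s a b 0 | a b. theta_B p l \<mu> a b 0 = id}"
    and "card (thompson_subgroup (group_B p l \<mu> s)) = CARD('a) ^ 2"
proof -
  have J: "thompson_subgroup (group_B p l \<mu> s) = J"
    unfolding group_B_eq using assms p_gt_1
    by (intro thompson_subgroup_eq_J) (simp_all add: tr.zero)
  then show "thompson_subgroup (group_B p l \<mu> s) =
      {elem_B p l \<mu> s a b 0 | a b. theta_B p l \<mu> a b 0 = id}"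
    unfolding J_eq elem_B_eq theta_B_def .
  show "card (thompson_subgroup (group_B p l \<mu> s)) = CARD('a) ^ 2"
    unfolding J card_J by (simp add: tr.zero power2_eq_square)
qed

end

locale construction_C = frobenius_lin_poly p l s
  for p l :: nat and s :: "nat \<Rightarrow> 'a::{field, finite}" +
  fixes \<mu> :: 'a
  assumes odd_p: "odd p" and \<mu>_in_Fpl: "\<mu> \<in> Fpl p l"
    and coeffs_symmetric:
      "i \<in> {1..p * l - 1} \<Longrightarrow> \<mu> * s i - s (p * l - i) ^ (p ^ i) * \<mu> ^ (p ^ i) = 0"
begin

lemma tr_mult_S_commute: "tr p l (\<mu> * x * S y) = tr p l (\<mu> * y * S x)"
proof -
  define f where "f = (\<lambda>i x y. tr p l (\<mu> * s i * x * y ^ p ^ i))"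
  have expand: "tr p l (\<mu> * x * S y) = f 0 x y + (\<Sum>i\<in>{1..p * l - 1}. f i x y)" for x y
  proof -
    have "tr p l (\<mu> * x * S y) = (\<Sum>i<p * l. f i x y)"
      by (simp add: poly_lin_poly f_def sum_distrib_left tr.sum mult_ac)
    also have "{..<p * l} = insert 0 {1..p * l - 1}"
      using p_gt_1 l_pos by auto
    finally show ?thesis
      by simp
  qed
  have reflect: "f (p * l - i) y x = f i x y" if i: "i \<in> {1..p * l - 1}" for i
  proof -
    have "p * l - i + i = p * l"
      using i by auto
    then have "(\<mu> * s (p * l - i) * y * x ^ p ^ (p * l - i)) ^ p ^ i =
        (\<mu> ^ p ^ i * s (p * l - i) ^ p ^ i) * y ^ p ^ i * x ^ p ^ (p * l)"
      by (simp add: power_mult_distrib flip: power_mult power_add)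
    also have "\<dots> = \<mu> * s i * x * y ^ p ^ i"
      unfolding power_CARD using coeffs_symmetric[OF i] by (simp add: mult_ac)
    finally show ?thesis
      unfolding f_def using tr_power_p by metis
  qed
  have "(\<Sum>i\<in>{1..p * l - 1}. f i x y) = (\<Sum>i\<in>{1..p * l - 1}. f i y x)"
    by (rule sum.reindex_bij_witness[of _ "\<lambda>i. p * l - i" "\<lambda>i. p * l - i"]) (auto simp: reflect)
  then show ?thesis
    unfolding expand by (simp add: f_def mult_ac)
qed

lemma Q_C_add: "Q_C p l \<mu> s (x + y) = Q_C p l \<mu> s x + Q_C p l \<mu> s y - 2 * tr p l (\<mu> * x * S y)"
  using tr_mult_S_commute[of y x] by (simp add: Q_C_def S.add tr.add algebra_simps)

lemma Q_C_funpow_frob: "Q_C p l \<mu> s ((frob p l ^^ n) x) = Q_C p l \<mu> s x"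
  using tr_mult_funpow_frob[OF \<mu>_in_Fpl, of n "x * S x"]
  by (simp add: Q_C_def S_funpow_frob frob.mult mult.assoc)

lemma Q_C_0: "Q_C p l \<mu> s 0 = 0"
  by (simp add: Q_C_def tr.zero)

sublocale frobenius_twisted_group p l s "\<lambda>b c. 1 / 2 * Q_C p l \<mu> s c + tr p l (\<mu> * b)"
proof
  have half: "1 / 2 * Q_C p l \<mu> s c = Q_C p l \<mu> s c / of_nat 2" for c
    by simp
  show "1 / 2 * Q_C p l \<mu> s c + tr p l (\<mu> * b) \<in> Fpl p 1" for b c
    unfolding half unfolding Q_C_def
    by (intro Fpl_add Fpl_minus Fpl_divide of_nat_in_Fpl tr_in_prime_field)
  show "1 / 2 * Q_C p l \<mu> s ((frob p l ^^ n) c1 + c2) +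
      tr p l (\<mu> * ((frob p l ^^ n) b1 + b2 + (frob p l ^^ n) c1 * S c2)) =
      1 / 2 * Q_C p l \<mu> s c1 + tr p l (\<mu> * b1) + (1 / 2 * Q_C p l \<mu> s c2 + tr p l (\<mu> * b2))"
    for n b1 b2 c1 c2
  proof -
    have "1 / 2 * Q_C p l \<mu> s ((frob p l ^^ n) c1 + c2) + tr p l (\<mu> * (frob p l ^^ n) c1 * S c2) =
        1 / 2 * Q_C p l \<mu> s c1 + 1 / 2 * Q_C p l \<mu> s c2"
      using two_neq_0[OF odd_p]
      by (simp add: Q_C_add Q_C_funpow_frob add_divide_distrib diff_divide_distrib)
    then show ?thesis
      by (simp add: distrib_left tr.add tr_mult_funpow_frob[OF \<mu>_in_Fpl] mult.assoc add_ac)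
  qed
qed

lemma elem_C_eq: "elem_C p l \<mu> s = elem"
  and group_C_eq: "group_C p l \<mu> s = G"
  by (simp_all add: elem_C_def group_C_def theta_C_def[abs_def])

theorem thompson_subgroup_group_C:
  assumes "1 < degree (lin_poly p l s)" "p * degree (lin_poly p l s) < CARD('a)" and "\<mu> \<noteq> 0"
  shows "thompson_subgroup (group_C p l \<mu> s) =
      {elem_C p l \<mu> s a b 0 | a b. theta_C p l \<mu> s a b 0 = id}"
    and "p * card (thompson_subgroup (group_C p l \<mu> s)) = CARD('a) ^ 2"
proof -
  have J: "thompson_subgroup (group_C p l \<mu> s) = J"
    unfolding group_C_eq using assms(1,2) odd_p
    by (intro thompson_subgroup_eq_J) (simp_all add: Q_C_0 card_tr_kernel[OF \<open>\<mu> \<noteq> 0\<close>])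
  then show "thompson_subgroup (group_C p l \<mu> s) =
      {elem_C p l \<mu> s a b 0 | a b. theta_C p l \<mu> s a b 0 = id}"
    unfolding J_eq elem_C_eq theta_C_def .
  show "p * card (thompson_subgroup (group_C p l \<mu> s)) = CARD('a) ^ 2"
    unfolding J card_J using card_tr_kernel[OF \<open>\<mu> \<noteq> 0\<close>]
    by (simp add: Q_C_0 power2_eq_square mult_ac)
qed

end

theorem theorem8p4:
  fixes p l :: nat and s :: "nat \<Rightarrow> 'a::{field, finite}" and \<mu> :: 'a
  assumes "prime p" and "odd p" and "l \<ge> 1"
    and "CARD('a) = p ^ (p * l)"
    and "\<forall>i<p * l. s i \<in> Fpl p l"
    and "\<mu> \<in> Fpl p l" and "\<mu> \<noteq> 0"
    and "1 < degree (lin_poly p l s)"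
    and "real (degree (lin_poly p l s)) < real CARD('a) / real p"
  shows
    "(thompson_subgroup (group_B p l \<mu> s) =
        {elem_B p l \<mu> s a b 0 | a b. theta_B p l \<mu> a b 0 = id} \<and>
      card (thompson_subgroup (group_B p l \<mu> s)) = CARD('a) ^ 2) \<and>
     ((\<forall>i\<in>{1..p * l - 1}. \<mu> * s i - s (p * l - i) ^ (p ^ i) * \<mu> ^ (p ^ i) = 0) \<longrightarrow>
      thompson_subgroup (group_C p l \<mu> s) =
        {elem_C p l \<mu> s a b 0 | a b. theta_C p l \<mu> s a b 0 = id} \<and>
      real (card (thompson_subgroup (group_C p l \<mu> s))) = real CARD('a) ^ 2 / real p)"
    (is "?B \<and> (?symmetric \<longrightarrow> ?C)")
proof -
  interpret B: construction_B p l s \<mu>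
    using assms by unfold_locales auto
  have "real (p * degree (lin_poly p l s)) < real CARD('a)"
    using assms(9) B.p_gt_1 by (simp add: field_simps)
  then have degree: "p * degree (lin_poly p l s) < CARD('a)"
    by linarith
  have ?C if ?symmetric
  proof -
    interpret C: construction_C p l s \<mu>
      using assms that by unfold_locales auto
    note thompson = C.thompson_subgroup_group_C[OF assms(8) degree assms(7)]
    have "real p * real (card (thompson_subgroup (group_C p l \<mu> s))) = real CARD('a) ^ 2"
      using arg_cong[OF thompson(2), of real] by simp
    then show ?thesis
      using thompson(1) B.p_gt_1 by (simp add: field_simps)
  qed
  then show ?thesis
    using B.thompson_subgroup_group_B[OF assms(2,8) degree] by blast
qed

end
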